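(* Let $\kappa<\lambda$ be cardinals with $\mathrm{cf}(\lambda)=\kappa$ and $2^{<\lambda}=\lambda$, and let $U$ be a normal, fine ultrafilter on $P_\kappa(\lambda)$. Then $\lnot\mathrm{Gal}(U,(2^\kappa)^+,2^\lambda)$.
   Context: $P_\kappa(\lambda)=\{x\subseteq\lambda : |x|<\kappa\}$. An ultrafilter $U$ on $P_\kappa(\lambda)$ is fine if $\{x\in P_\kappa(\lambda):\alpha\in x\}\in U$ for every $\alpha<\lambda$, and normal if whenever $X_\alpha\in U$ for $\alpha<\lambda$, the diagonal intersection $\triangle_{\alpha<\lambda}X_\alpha=\{x\in P_\kappa(\lambda):\forall\alpha\in x\,(x\in X_\alpha)\}$ is in $U$. For a filter $F$ and cardinals $\mu\le\nu$, $\mathrm{Gal}(F,\mu,\nu)$ means: for every sequence $\langle A_i:i<\nu\rangle$ of sets in $F$ there is $I\subseteq\nu$ with $|I|=\mu$ such that $\bigcap_{i\in I}A_i\in F$. *)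

theory Defs
  imports Main
begin

text \<open>Cardinals are \<^const>\<open>Card_order\<close> relations on arbitrary types, compared by
  \<open>=o\<close> and \<open><o\<close>; the ordinals below a cardinal \<open>l\<close> are the elements of \<open>Field l\<close>.\<close>

unbundle cardinal_syntax

text \<open>\<open>cf(r) = k\<close>: the least cardinality of a cofinal subset of \<open>r\<close> is \<open>k\<close>. The library's
  \<^const>\<open>cofinal\<close> asks for strictly larger elements, which makes no difference for limit orders;
  a finite nonzero cardinal has no cofinal set and hence no cofinality here.\<close>

definition has_cofinality :: "'a rel \<Rightarrow> 'b rel \<Rightarrow> bool" where
  "has_cofinality r k \<longleftrightarrow>
     (\<exists>K \<subseteq> Field r. cofinal K r \<and> |K| =o k) \<and>
     (\<forall>K \<subseteq> Field r. cofinal K r \<longrightarrow> k \<le>o |K| )"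

text \<open>\<open>2^{<r} = s\<close>: \<open>s\<close> is the least cardinal greater than or equal to \<open>2^m\<close> for all cardinals \<open>m < r\<close>. Up to
  \<open>=o\<close>, every cardinal below \<open>r\<close> lives on the type of \<open>r\<close>, and every cardinal below \<open>s\<close> on the
  type of \<open>s\<close>, so it suffices that \<open>m\<close> and \<open>t\<close> range over these types.\<close>

definition is_two_powlt :: "'a rel \<Rightarrow> 'b rel \<Rightarrow> bool" where
  "is_two_powlt r s \<longleftrightarrow>
     Card_order s \<and>
     (\<forall>m :: 'a rel. Card_order m \<and> m <o r \<longrightarrow> ctwo ^c m \<le>o s) \<and>
     (\<forall>t :: 'b rel. Card_order t \<and>
        (\<forall>m :: 'a rel. Card_order m \<and> m <o r \<longrightarrow> ctwo ^c m \<le>o t) \<longrightarrow> s \<le>o t)"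

definition Pk :: "'b rel \<Rightarrow> 'a rel \<Rightarrow> 'a set set" where
  "Pk k l = {x. x \<subseteq> Field l \<and> |x| <o k}"

text \<open>Ultrafilters on a set \<open>S\<close>, as families of subsets of \<open>S\<close>; they are proper, and no
  completeness is required.\<close>

definition ultrafilter_on :: "'s set \<Rightarrow> 's set set \<Rightarrow> bool" where
  "ultrafilter_on S U \<longleftrightarrow>
     U \<subseteq> Pow S \<and> S \<in> U \<and> {} \<notin> U \<and>
     (\<forall>X Y. X \<in> U \<and> X \<subseteq> Y \<and> Y \<subseteq> S \<longrightarrow> Y \<in> U) \<and>
     (\<forall>X Y. X \<in> U \<and> Y \<in> U \<longrightarrow> X \<inter> Y \<in> U) \<and>
     (\<forall>X. X \<subseteq> S \<longrightarrow> X \<in> U \<or> S - X \<in> U)"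

definition fine :: "'b rel \<Rightarrow> 'a rel \<Rightarrow> 'a set set set \<Rightarrow> bool" where
  "fine k l U \<longleftrightarrow> (\<forall>\<alpha> \<in> Field l. {x \<in> Pk k l. \<alpha> \<in> x} \<in> U)"

definition diag_inter :: "'b rel \<Rightarrow> 'a rel \<Rightarrow> ('a \<Rightarrow> 'a set set) \<Rightarrow> 'a set set" where
  "diag_inter k l X = {x \<in> Pk k l. \<forall>\<alpha> \<in> x. x \<in> X \<alpha>}"

definition normal_uf :: "'b rel \<Rightarrow> 'a rel \<Rightarrow> 'a set set set \<Rightarrow> bool" where
  "normal_uf k l U \<longleftrightarrow>
     (\<forall>X. (\<forall>\<alpha> \<in> Field l. X \<alpha> \<in> U) \<longrightarrow> diag_inter k l X \<in> U)"

definition Gal :: "'s set set \<Rightarrow> 'm rel \<Rightarrow> 'n rel \<Rightarrow> bool" where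
  "Gal F m n \<longleftrightarrow>
     (\<forall>A. (\<forall>i \<in> Field n. A i \<in> F) \<longrightarrow>
        (\<exists>I \<subseteq> Field n. |I| =o m \<and> (\<Inter>i\<in>I. A i) \<in> F))"

end

(* For K cofinal in l with |K| = k and f : K -> l, normality and fineness put the set
   {x. \<forall>\<alpha>\<in>x \<inter> K. f \<alpha> \<in> x} of points closed under f into U. Since every proper initial segment
   of l has at most l subsets, a subset X of l is coded by such an f, sending \<alpha> to a code of the
   trace of X below \<alpha>; this gives 2^l sets. If a family I of functions yields an intersection
   in U, then by fineness each \<alpha> \<in> K lies in a point x closed under all f \<in> I, so that
   {f \<alpha> | f \<in> I} \<subseteq> x has size less than k. Hence |I| \<le> k^k = 2^k. *)
theory Submission
  imports Defs
begin

text \<open>A finite nonempty set has a maximal element, while \<open>cofinal\<close> asks for a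
  strictly larger one in the set. This is how \<open>k\<close> is shown to be infinite.\<close>

lemma cofinal_infinite:
  assumes "Card_order r" "K \<subseteq> Field r" "cofinal K r" "Field r \<noteq> {}"
  shows "infinite K"
proof
  assume fin: "finite K"
  have wo: "Well_order r" using assms(1) by (rule card_order_on_well_order_on)
  have ne: "K \<noteq> {}" using assms(3,4) by (auto simp: cofinal_def)
  from wo have trans: "trans r" and anti: "antisym r"
    by (auto simp: order_on_defs)
  have "\<exists>m\<in>K. \<forall>b\<in>K. (m, b) \<in> r \<longrightarrow> m = b"
    using fin ne
  proof (induction K rule: finite_ne_induct)
    case (singleton x)
    then show ?case by simp
  next
    case (insert x F)
    then obtain m where m: "m \<in> F" "\<forall>b\<in>F. (m, b) \<in> r \<longrightarrow> m = b" by blast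
    show ?case
    proof (cases "(m, x) \<in> r")
      case True
      \<comment> \<open>Any \<open>b\<close> of \<open>F\<close> above \<open>x\<close> is above
        \<open>m\<close>, hence equal to \<open>m\<close>; antisymmetry then identifies
        \<open>x\<close> with it.\<close>
      then have "\<forall>b\<in>F. (x, b) \<in> r \<longrightarrow> x = b"
        using m(2) transD[OF trans True] antisymD[OF anti True] by blast
      then show ?thesis by blast
    next
      case False
      then show ?thesis using m by blast
    qed
  qed
  then obtain m where "m \<in> K" "\<forall>b\<in>K. (m, b) \<in> r \<longrightarrow> m = b" by blast
  then show False using assms(2,3) by (auto simp: cofinal_def)
qed

lemma card_of_Pow_ctwo_cexp: "|Pow (Field r)| =o ctwo ^c r"
  unfolding ctwo_def cexp_def Field_card_of by (rule card_of_Pow_Func)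

lemma closed_points_in_normal_uf:
  assumes "ultrafilter_on (Pk k l) U" "normal_uf k l U" "fine k l U"
    and "f ` K \<subseteq> Field l"
  shows "{x \<in> Pk k l. \<forall>\<alpha>\<in>x \<inter> K. f \<alpha> \<in> x} \<in> U"
proof -
  \<comment> \<open>The diagonal intersection runs over all of \<open>x\<close>; the default
    \<open>Pk k l\<close> makes indices outside \<open>K\<close> impose nothing.\<close>
  let ?X = "\<lambda>\<alpha>. if \<alpha> \<in> K then {x \<in> Pk k l. f \<alpha> \<in> x} else Pk k l"
  have "\<forall>\<alpha>\<in>Field l. ?X \<alpha> \<in> U"
    using assms(1,3,4) by (auto simp: fine_def ultrafilter_on_def)
  then have "diag_inter k l ?X \<in> U"
    using assms(2)[unfolded normal_uf_def, THEN spec[where x = ?X]] by (rule rev_mp)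
  also have "diag_inter k l ?X = {x \<in> Pk k l. \<forall>\<alpha>\<in>x \<inter> K. f \<alpha> \<in> x}"
    by (auto simp: diag_inter_def)
  finally show ?thesis .
qed

text \<open>The hypothesis on powers below \<open>l\<close> enters here: \<open>l\<close> is a
  cardinal, so its proper initial segments have size less than \<open>l\<close>.\<close>

lemma Pow_underS_ordLeq:
  assumes "Card_order l" "infinite (Field l)" "is_two_powlt l l" "i \<in> Field l"
  shows "|Pow (underS l i)| \<le>o l"
proof -
  have "|underS l i| <o l" using assms by (simp add: card_of_underS)
  then have "ctwo ^c |underS l i| \<le>o l"
    using assms(3) card_of_Card_order unfolding is_two_powlt_def by blast
  moreover have "|Pow (underS l i)| =o ctwo ^c |underS l i|"
    using card_of_Pow_ctwo_cexp[of "|underS l i|"] unfolding Field_card_of .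
  ultimately show ?thesis using ordIso_ordLeq_trans by blast
qed

text \<open>A subset of \<open>l\<close>, given by its characteristic function \<open>p\<close>, is
  the union of its traces below the elements of the cofinal set \<open>K\<close>, so the codes of
  these traces determine it.\<close>

lemma code_by_functions_on_cofinal_set:
  assumes "Card_order l" "infinite (Field l)" "is_two_powlt l l"
    and "K \<subseteq> Field l" "cofinal K l"
  obtains F where "\<And>p. F p ` K \<subseteq> Field l"
    "\<And>p q. \<lbrakk>p \<in> Field (ctwo ^c l); q \<in> Field (ctwo ^c l); \<forall>i\<in>K. F p i = F q i\<rbrakk> \<Longrightarrow> p = q"
proof -
  have "\<exists>g. inj_on g (Pow (underS l i)) \<and> g ` Pow (underS l i) \<subseteq> Field l" if "i \<in> K" for i
  proof -
    have "|Pow (underS l i)| \<le>o |Field l|"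
      using Pow_underS_ordLeq[OF assms(1-3)] that assms(4)
        ordLeq_ordIso_trans[OF _ ordIso_symmetric[OF card_of_Field_ordIso[OF assms(1)]]] by blast
    then show ?thesis by (simp add: card_of_ordLeq)
  qed
  then obtain g where g: "\<And>i. i \<in> K \<Longrightarrow> inj_on (g i) (Pow (underS l i))"
      "\<And>i. i \<in> K \<Longrightarrow> g i ` Pow (underS l i) \<subseteq> Field l"
    by metis
  define F where "F p i = g i {a \<in> underS l i. p a}" for p i
  show ?thesis
  proof
    show "F p ` K \<subseteq> Field l" for p using g(2) by (fastforce simp: F_def)
    fix p q
    assume p: "p \<in> Field (ctwo ^c l)" and q: "q \<in> Field (ctwo ^c l)" and eq: "\<forall>i\<in>K. F p i = F q i"
    show "p = q"
    proof
      fix a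
      show "p a = q a"
      proof (cases "a \<in> Field l")
        case True
        then obtain i where i: "i \<in> K" "a \<in> underS l i"
          using assms(5) by (auto simp: cofinal_def underS_def)
        then have "{a \<in> underS l i. p a} = {a \<in> underS l i. q a}"
          using eq inj_onD[OF g(1)[OF i(1)]] by (auto simp: F_def)
        then show ?thesis using i(2) by blast
      next
        case False
        \<comment> \<open>Elements of \<open>Func\<close> take the value \<open>undefined\<close>
          outside their domain, so \<open>p\<close> and \<open>q\<close> agree there too.\<close>
        then show ?thesis using p q unfolding cexp_def Field_card_of by (simp add: Func_def)
      qed
    qed
  qed
qed

text \<open>Relabelling the values at each \<open>i\<close> by elements of \<open>k\<close> embeds
  \<open>I\<close> into the functions from \<open>K\<close> to \<open>k\<close>. No common bound
  below \<open>k\<close> on the value sets is required.\<close>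

lemma card_of_pointwise_bounded_functions:
  assumes k: "Card_order k" "infinite (Field k)" and K: "|K| =o k"
    and small: "\<And>i. i \<in> K \<Longrightarrow> |(\<lambda>p. F p i) ` I| <o k"
    and inj: "\<And>p q. \<lbrakk>p \<in> I; q \<in> I; \<forall>i\<in>K. F p i = F q i\<rbrakk> \<Longrightarrow> p = q"
  shows "|I| \<le>o ctwo ^c k"
proof -
  have "\<exists>h. inj_on h ((\<lambda>p. F p i) ` I) \<and> h ` (\<lambda>p. F p i) ` I \<subseteq> Field k" if "i \<in> K" for i
  proof -
    have "|(\<lambda>p. F p i) ` I| \<le>o |Field k|"
      using ordLess_imp_ordLeq[OF small[OF that]]
        ordLeq_ordIso_trans[OF _ ordIso_symmetric[OF card_of_Field_ordIso[OF k(1)]]] by blast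
    then show ?thesis by (simp add: card_of_ordLeq)
  qed
  then obtain h where h: "\<And>i. i \<in> K \<Longrightarrow> inj_on (h i) ((\<lambda>p. F p i) ` I)"
      "\<And>i. i \<in> K \<Longrightarrow> h i ` (\<lambda>p. F p i) ` I \<subseteq> Field k"
    by metis
  \<comment> \<open>The graph of the relabelled function, so that counting functions becomes
    counting subsets of a product of size at most \<open>k\<close>.\<close>
  let ?G = "\<lambda>p. (\<lambda>i. (i, h i (F p i))) ` K"
  have "inj_on ?G I"
  proof (rule inj_onI)
    fix p q assume pq: "p \<in> I" "q \<in> I" "?G p = ?G q"
    have "F p i = F q i" if i: "i \<in> K" for i
    proof -
      have "(i, h i (F p i)) \<in> ?G q" using i unfolding pq(3)[symmetric] by (rule imageI)
      then have "h i (F p i) = h i (F q i)" by auto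
      then show ?thesis using inj_onD[OF h(1)[OF i]] pq(1,2) by blast
    qed
    then show "p = q" using inj pq by blast
  qed
  moreover have "?G ` I \<subseteq> Pow (K \<times> Field k)" using h(2) by auto
  ultimately have "|I| \<le>o |Pow (K \<times> Field k)|" using card_of_ordLeq by blast
  also have "|Pow (K \<times> Field k)| \<le>o |Pow (Field k)|"
  proof -
    note kF = card_of_Field_ordIso[OF k(1)]
    have "|K \<times> Field k| \<le>o |Field k|"
      using card_of_Times_ordLeq_infinite_Field[OF k(2) ordIso_imp_ordLeq[OF K] ordIso_imp_ordLeq[OF kF] k(1)]
        ordIso_symmetric[OF kF] by (rule ordLeq_ordIso_trans)
    then obtain f where "inj_on f (K \<times> Field k)" "f ` (K \<times> Field k) \<subseteq> Field k"
      unfolding card_of_ordLeq[symmetric] by (elim exE conjE)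
    then have "inj_on ((`) f) (Pow (K \<times> Field k)) \<and> (`) f ` Pow (K \<times> Field k) \<subseteq> Pow (Field k)"
      by (auto intro: inj_on_image_Pow)
    then show ?thesis unfolding card_of_ordLeq[symmetric] by (rule exI[where x = "(`) f"])
  qed
  also have "|Pow (Field k)| =o ctwo ^c k" by (rule card_of_Pow_ctwo_cexp)
  finally show ?thesis .
qed

theorem theorem2p16:
  fixes k :: "'k rel" and l :: "'l rel" and U :: "'l set set set"
  assumes "Card_order k" and "Card_order l"
    and "k <o l"
    and "has_cofinality l k"
    and "is_two_powlt l l"
    and "ultrafilter_on (Pk k l) U"
    and "normal_uf k l U"
    and "fine k l U"
  shows "\<not> Gal U (cardSuc (ctwo ^c k)) (ctwo ^c l)"
proof
  assume gal: "Gal U (cardSuc (ctwo ^c k)) (ctwo ^c l)"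
  obtain K where K: "K \<subseteq> Field l" "cofinal K l" "|K| =o k"
    using assms(4) unfolding has_cofinality_def by blast
  have "Field l \<noteq> {}"
  proof
    assume "Field l = {}"
    then have "l \<le>o k"
      using card_of_Field_ordIso[OF assms(2)] Card_order_empty[OF assms(1)]
      using ordIso_ordLeq_trans[OF ordIso_symmetric] by fastforce
    then show False using assms(3) not_ordLess_ordLeq by blast
  qed
  then have "infinite K" using cofinal_infinite[OF assms(2)] K by blast
  then have inf: "infinite (Field l)" "infinite (Field k)"
    using K finite_subset card_of_ordIso_finite_Field[OF assms(1)] ordIso_symmetric by blast+
  obtain F where F: "\<And>p. F p ` K \<subseteq> Field l"
    and F_inj: "\<And>p q. \<lbrakk>p \<in> Field (ctwo ^c l); q \<in> Field (ctwo ^c l); \<forall>i\<in>K. F p i = F q i\<rbrakk> \<Longrightarrow> p = q"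
    using code_by_functions_on_cofinal_set[OF assms(2) inf(1) assms(5) K(1,2)] by blast
  let ?A = "\<lambda>p. {x \<in> Pk k l. \<forall>\<alpha>\<in>x \<inter> K. F p \<alpha> \<in> x}"
  have "\<forall>p\<in>Field (ctwo ^c l). ?A p \<in> U"
    using closed_points_in_normal_uf[OF assms(6-8) F] by blast
  then obtain I where I: "I \<subseteq> Field (ctwo ^c l)" "|I| =o cardSuc (ctwo ^c k)"
      "(\<Inter>p\<in>I. ?A p) \<in> U"
    using gal[unfolded Gal_def, THEN spec[where x = ?A]] by (elim impE exE conjE)
  have "|(\<lambda>p. F p i) ` I| <o k" if i: "i \<in> K" for i
  proof -
    have "{x \<in> Pk k l. i \<in> x} \<in> U" using assms(8) i K(1) by (auto simp: fine_def)
    moreover have "X \<inter> Y \<noteq> {}" if "X \<in> U" "Y \<in> U" for X Y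
      using assms(6) that unfolding ultrafilter_on_def by metis
    \<comment> \<open>A single point \<open>x\<close> containing \<open>i\<close> serves all
      \<open>p\<close> in \<open>I\<close> at once, so it contains every value
      \<open>F p i\<close>.\<close>
    ultimately have "{x \<in> Pk k l. i \<in> x} \<inter> (\<Inter>p\<in>I. ?A p) \<noteq> {}"
      using I(3) by simp
    then obtain x where "x \<in> {x \<in> Pk k l. i \<in> x} \<inter> (\<Inter>p\<in>I. ?A p)"
      by (meson ex_in_conv)
    then have x: "x \<in> Pk k l" "i \<in> x" "\<forall>p\<in>I. x \<in> ?A p"
      by simp_all
    then have "(\<lambda>p. F p i) ` I \<subseteq> x" using i by fast
    then show ?thesis
      using x(1) card_of_mono1 ordLeq_ordLess_trans unfolding Pk_def by blast
  qed
  moreover have "p = q" if "p \<in> I" "q \<in> I" "\<forall>i\<in>K. F p i = F q i" for p q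
    using that by (intro F_inj subsetD[OF I(1)])
  ultimately have "|I| \<le>o ctwo ^c k"
    by (rule card_of_pointwise_bounded_functions[OF assms(1) inf(2) K(3)])
  \<comment> \<open>The set \<open>I\<close> was chosen of size the successor of this bound.\<close>
  then have "cardSuc (ctwo ^c k) \<le>o ctwo ^c k"
    using I(2) ordIso_ordLeq_trans ordIso_symmetric by blast
  then show False
    using cardSuc_greater[of "ctwo ^c k"] Card_order_cexp not_ordLess_ordLeq by blast
qed

end
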